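(* For every integer $t \ge 0$, $f'(t;\{0,1\}) = 2^{t+1}$.
   Context: For $p,q \in X^n$, $\mathrm{dist}(p,q)$ is the Hamming distance, i.e. the number of coordinates in which $p$ and $q$ differ. For a set $X$, $f'(t;X)$ is defined as the maximum $m$ such that there exist an integer $n > t$ and $a_1,\dots,a_m,b_1,\dots,b_m \in X^n$ with $\mathrm{dist}(a_i,b_i) \ge t+1$ for all $i \in [m]$ and $\mathrm{dist}(a_i,b_j) + \mathrm{dist}(a_j,b_i) \le 2t$ for all distinct $i,j \in [m]$. *)

theory Defs
  imports Complex_Main "HOL-Library.FuncSet"
begin

text \<open>A point of \<open>X\<^sup>n\<close> is a function in \<open>{..<n} \<rightarrow>\<^sub>E X\<close>, with coordinates indexed by \<open>0, \<dots>, n - 1\<close>.\<close>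

definition hamming_dist :: "nat \<Rightarrow> (nat \<Rightarrow> 'a) \<Rightarrow> (nat \<Rightarrow> 'a) \<Rightarrow> nat" where
  "hamming_dist n p q = card {k \<in> {..<n}. p k \<noteq> q k}"

definition admissible :: "nat \<Rightarrow> 'a set \<Rightarrow> nat \<Rightarrow> bool" where
  "admissible t X m \<longleftrightarrow>
    (\<exists>n > t. \<exists>a b :: nat \<Rightarrow> nat \<Rightarrow> 'a.
      (\<forall>i \<in> {1..m}. a i \<in> {..<n} \<rightarrow>\<^sub>E X \<and> b i \<in> {..<n} \<rightarrow>\<^sub>E X) \<and>
      (\<forall>i \<in> {1..m}. hamming_dist n (a i) (b i) \<ge> t + 1) \<and>
      (\<forall>i \<in> {1..m}. \<forall>j \<in> {1..m}. i \<noteq> j \<longrightarrow>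
         hamming_dist n (a i) (b j) + hamming_dist n (a j) (b i) \<le> 2 * t))"

text \<open>The value of \<open>GREATEST\<close> is meaningful only if a maximum exists, so an equation for
  \<open>f_prime\<close> should be accompanied by the statement that this maximum exists.\<close>

definition f_prime :: "nat \<Rightarrow> 'a set \<Rightarrow> nat" where
  "f_prime t X = (GREATEST m. admissible t X m)"

end

theory Submission
  imports Defs
begin

text \<open>Lower bound: for \<open>n = t + 1\<close> take all binary words, each paired with its complement.

  Upper bound: let \<open>D\<^sub>i\<close> be the set of coordinates where \<open>a\<^sub>i\<close> and \<open>b\<^sub>i\<close> differ. Over a binary
  alphabet the hypotheses give
  \<open>|D\<^sub>i| + |D\<^sub>j| \<le> 2 t + 2 |{k \<in> D\<^sub>i \<inter> D\<^sub>j. a\<^sub>i k \<noteq> a\<^sub>j k}|\<close>.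
  If \<open>|D\<^sub>i| - t\<close> is even, remove the least element from \<open>D\<^sub>i\<close>; as always the least element is removed,
  any two of the sets lose together at most one common coordinate. Afterwards
  \<open>|D\<^sub>i| = t + 1 + 2 r\<^sub>i\<close>, and the words \<open>a\<^sub>i\<close>, \<open>a\<^sub>j\<close> differ in more than
  \<open>r\<^sub>i + r\<^sub>j\<close> coordinates of \<open>D\<^sub>i \<inter> D\<^sub>j\<close>. Hence the sets of words having at most \<open>r\<^sub>i\<close>
  disagreements with \<open>a\<^sub>i\<close> on \<open>D\<^sub>i\<close> are disjoint, and each of them contains at least
  the fraction \<open>2\<^bsup>-(t+1)\<^esup>\<close> of all words.\<close>

text \<open>As \<open>card C\<close> is odd, complementation in \<open>C\<close> swaps the subsets
  of size at most \<open>r\<close> with those of size above \<open>r\<close>, so each kind is half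
  of \<open>Pow C\<close>.\<close>

lemma card_small_subsets_odd:
  assumes "card C = 2 * r + 1"
  shows "card {S \<in> Pow C. card S \<le> r} = 2 ^ (2 * r)"
proof -
  let ?L = "{S \<in> Pow C. card S \<le> r}" and ?H = "{S \<in> Pow C. r < card S}"
  have fin: "finite C"
    using assms by (metis add_is_0 card.infinite one_neq_zero)
  have compl: "card (C - S) = 2 * r + 1 - card S" if "S \<subseteq> C" for S
    using card_Diff_subset[OF finite_subset[OF that fin] that] assms by simp
  have "bij_betw (\<lambda>S. C - S) ?L ?H"
    by (rule bij_betwI[where g = "\<lambda>S. C - S"]) (auto simp: compl double_diff)
  then have "card ?L = card ?H"
    by (rule bij_betw_same_card)
  moreover have "card ?L + card ?H = card (Pow C)"
    by (subst card_Un_disjoint[symmetric]) (use fin in \<open>auto intro: arg_cong[where f = card]\<close>)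
  ultimately show ?thesis
    using assms fin by (simp add: card_Pow)
qed

text \<open>It suffices to count the sets \<open>S\<close> that meet \<open>D\<close> only inside a
  fixed \<open>C\<close> of size \<open>2 * r + 1\<close>: there are \<open>2 ^ (2 * r)\<close>
  choices on \<open>C\<close> and free choice on \<open>N - D\<close>.\<close>

lemma card_subsets_meeting_in_few:
  assumes "finite N" "D \<subseteq> N" "card D = t + 1 + 2 * r"
  shows "2 ^ (card N - (t + 1)) \<le> card {S \<in> Pow N. card (S \<inter> D) \<le> r}"
proof -
  have finD: "finite D" using assms finite_subset by blast
  obtain C where C: "C \<subseteq> D" "card C = 2 * r + 1"
    using obtain_subset_with_card_n[of "2 * r + 1" D] assms(3) by auto
  let ?P = "{S \<in> Pow C. card S \<le> r} \<times> Pow (N - D)"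
  have "inj_on (\<lambda>(U, V). U \<union> V) ?P"
    by (rule inj_on_inverseI[where g = "\<lambda>S. (S \<inter> C, S - D)"]) (use C(1) in auto)
  moreover have "(\<lambda>(U, V). U \<union> V) ` ?P \<subseteq> {S \<in> Pow N. card (S \<inter> D) \<le> r}"
  proof clarsimp
    fix U V assume UV: "U \<subseteq> C" "card U \<le> r" "V \<subseteq> N - D"
    then have "(U \<union> V) \<inter> D = U" using C(1) by blast
    then show "U \<subseteq> N \<and> V \<subseteq> N \<and> card ((U \<union> V) \<inter> D) \<le> r"
      using UV C(1) assms(2) by auto
  qed
  moreover have "finite {S \<in> Pow N. card (S \<inter> D) \<le> r}"
    using assms(1) by simp
  ultimately have "card ?P \<le> card {S \<in> Pow N. card (S \<inter> D) \<le> r}"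
    by (rule card_inj_on_le)
  moreover have "card ?P = 2 ^ (2 * r) * 2 ^ (card N - card D)"
    unfolding card_cartesian_product card_small_subsets_odd[OF C(2)]
    using assms finD by (simp add: card_Pow card_Diff_subset)
  moreover have "card D \<le> card N"
    using assms card_mono by blast
  then have "2 * r + (card N - card D) = card N - (t + 1)"
    using assms(3) by simp
  ultimately show ?thesis
    by (metis power_add)
qed

text \<open>A sphere packing bound. A binary word is encoded as the set of positions of its ones, so
  \<open>sym_diff\<close> gives the disagreements of two words; the ball \<open>F i\<close> measures
  distance on \<open>D i\<close> only.\<close>

lemma card_partial_words_le:
  fixes A D :: "'i \<Rightarrow> 'k set"
  assumes "finite N" "finite I" "t < card N"
    and A: "\<And>i. i \<in> I \<Longrightarrow> A i \<subseteq> N"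
    and D: "\<And>i. i \<in> I \<Longrightarrow> D i \<subseteq> N" "\<And>i. i \<in> I \<Longrightarrow> card (D i) = t + 1 + 2 * r i"
    and conflict: "\<And>i j. \<lbrakk>i \<in> I; j \<in> I; i \<noteq> j\<rbrakk> \<Longrightarrow>
      r i + r j < card (sym_diff (A i) (A j) \<inter> (D i \<inter> D j))"
  shows "card I \<le> 2 ^ (t + 1)"
proof -
  define F where "F i = {S \<in> Pow N. card (sym_diff S (A i) \<inter> D i) \<le> r i}" for i
  have finD: "finite (D i)" if "i \<in> I" for i
    using D(1)[OF that] assms(1) finite_subset by blast
  have card_F: "2 ^ (card N - (t + 1)) \<le> card (F i)" if i: "i \<in> I" for i
  proof -
    \<comment> \<open>Translation by \<open>A i\<close> is an involution that moves the centre of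
      the ball to the empty set.\<close>
    have "bij_betw (\<lambda>S. sym_diff S (A i)) (F i) {S \<in> Pow N. card (S \<inter> D i) \<le> r i}"
    proof (rule bij_betwI[where g = "\<lambda>S. sym_diff S (A i)"])
      have invol: "sym_diff (sym_diff S (A i)) (A i) = S" for S by blast
      show "sym_diff (sym_diff S (A i)) (A i) = S" for S by (rule invol)
      show "sym_diff (sym_diff S (A i)) (A i) = S" for S by (rule invol)
      show "(\<lambda>S. sym_diff S (A i)) \<in> F i \<rightarrow> {S \<in> Pow N. card (S \<inter> D i) \<le> r i}"
        using A[OF i] by (auto simp: F_def)
      show "(\<lambda>S. sym_diff S (A i)) \<in> {S \<in> Pow N. card (S \<inter> D i) \<le> r i} \<rightarrow> F i"
        using A[OF i] unfolding F_def Pi_iff mem_Collect_eq invol by blast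
    qed
    then have "card (F i) = card {S \<in> Pow N. card (S \<inter> D i) \<le> r i}"
      by (rule bij_betw_same_card)
    then show ?thesis
      using card_subsets_meeting_in_few[OF assms(1) D[OF i]] by simp
  qed
  have disj: "F i \<inter> F j = {}" if ij: "i \<in> I" "j \<in> I" "i \<noteq> j" for i j
  proof (rule equals0I)
    fix S assume S: "S \<in> F i \<inter> F j"
    let ?X = "sym_diff S (A i) \<inter> D i" and ?Y = "sym_diff S (A j) \<inter> D j"
    \<comment> \<open>Where \<open>A i\<close> and \<open>A j\<close> disagree, \<open>S\<close>
      disagrees with one of them.\<close>
    have "card (sym_diff (A i) (A j) \<inter> (D i \<inter> D j)) \<le> card (?X \<union> ?Y)"
      using finD ij by (intro card_mono) auto
    also have "\<dots> \<le> card ?X + card ?Y"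
      by (rule card_Un_le)
    also have "\<dots> \<le> r i + r j"
      using S by (simp add: F_def)
    finally show False
      using conflict[OF ij] by simp
  qed
  have "card I * 2 ^ (card N - (t + 1)) = (\<Sum>i\<in>I. 2 ^ (card N - (t + 1)))"
    by simp
  also have "\<dots> \<le> (\<Sum>i\<in>I. card (F i))"
    by (intro sum_mono card_F)
  also have "\<dots> = card (\<Union>i\<in>I. F i)"
    using assms disj by (subst card_UN_disjoint) (auto simp: F_def)
  also have "\<dots> \<le> card (Pow N)"
    using assms(1) by (intro card_mono) (auto simp: F_def)
  also have "\<dots> = 2 ^ (t + 1) * 2 ^ (card N - (t + 1))"
    using assms(1,3) by (simp add: card_Pow flip: power_add power_Suc)
  finally show ?thesis
    by simp
qed

text \<open>Reduction to odd excess over \<open>t\<close>. The order on coordinates makes the choice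
  of removed elements consistent across all \<open>D i\<close>.\<close>

lemma card_partial_words_mean_le:
  fixes A D :: "'i \<Rightarrow> 'k::linorder set"
  assumes "finite N" "finite I" "t < card N"
    and A: "\<And>i. i \<in> I \<Longrightarrow> A i \<subseteq> N"
    and D: "\<And>i. i \<in> I \<Longrightarrow> D i \<subseteq> N" "\<And>i. i \<in> I \<Longrightarrow> t + 1 \<le> card (D i)"
    and conflict: "\<And>i j. \<lbrakk>i \<in> I; j \<in> I; i \<noteq> j\<rbrakk> \<Longrightarrow>
      card (D i) + card (D j) \<le> 2 * t + 2 * card (sym_diff (A i) (A j) \<inter> (D i \<inter> D j))"
  shows "card I \<le> 2 ^ (t + 1)"
proof -
  define r where "r i = (card (D i) - (t + 1)) div 2" for i
  define R where "R i = (if even (card (D i) - t) then {Min (D i)} else {})" for i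
  have finD: "finite (D i)" if "i \<in> I" for i
    using D(1)[OF that] assms(1) finite_subset by blast
  have R_sub: "R i \<subseteq> D i" if "i \<in> I" for i
    using D(2)[OF that] finD[OF that] by (auto simp: R_def intro!: Min_in)
  have card_D: "card (D i) = t + 1 + 2 * r i + card (R i)" if "i \<in> I" for i
    using D(2)[OF that] unfolding r_def R_def
    by (cases "even (card (D i) - t)"; simp; presburger)
  have card_R: "card (R i) \<le> 1" for i
    by (simp add: R_def)
  show ?thesis
  proof (rule card_partial_words_le[OF assms(1-3) A, where D = "\<lambda>i. D i - R i" and r = r])
    fix i assume i: "i \<in> I"
    show "D i - R i \<subseteq> N" using D(1)[OF i] by blast
    have "finite (R i)" by (simp add: R_def)
    then show "card (D i - R i) = t + 1 + 2 * r i"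
      using card_D[OF i] R_sub[OF i] by (simp add: card_Diff_subset)
  next
    fix i j assume ij: "i \<in> I" "j \<in> I" "i \<noteq> j"
    let ?C = "sym_diff (A i) (A j) \<inter> (D i \<inter> D j)"
    let ?C' = "sym_diff (A i) (A j) \<inter> ((D i - R i) \<inter> (D j - R j))"
    have fin: "finite ?C" "finite ?C'" using finD ij by auto
    \<comment> \<open>The maximum matters: after halving, \<open>conflict\<close> leaves room for
      the mean of \<open>card (R i)\<close> and \<open>card (R j)\<close>, and integrality rounds
      this up to their maximum.\<close>
    have lost: "card (?C - ?C') \<le> max (card (R i)) (card (R j))"
    proof (cases "?C - ?C' = {}")
      case False
      then have ne: "R i \<noteq> {} \<or> R j \<noteq> {}" by blast
      \<comment> \<open>A lost element lies in both sets and is the minimum of one of them, so it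
        must be the larger of the two minima.\<close>
      have "x = y" if "x \<in> ?C - ?C'" "y \<in> ?C - ?C'" for x y
      proof -
        have "z = Min (D i) \<or> z = Min (D j)" if "z \<in> ?C - ?C'" for z
          using that by (auto simp: R_def split: if_splits)
        moreover have "Min (D i) \<le> z" "Min (D j) \<le> z" if "z \<in> ?C - ?C'" for z
          using that finD ij by auto
        ultimately show ?thesis
          using that by (metis order.antisym)
      qed
      then have "card (?C - ?C') \<le> 1"
        using card_le_Suc0_iff_eq[OF finite_Diff[OF fin(1)], of ?C'] by auto
      moreover have "max (card (R i)) (card (R j)) = 1"
        using ne by (auto simp: R_def split: if_splits)
      ultimately show ?thesis by simp
    next
      case True
      show ?thesis unfolding True by simp
    qed
    have "card ?C \<le> card (?C - ?C') + card ?C'"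
      using fin card_Un_le[of "?C - ?C'" ?C'] by (simp add: Un_absorb2 subset_iff)
    with lost card_R[of i] card_R[of j] conflict[OF ij] card_D[OF ij(1)] card_D[OF ij(2)]
    show "r i + r j < card ?C'" by linarith
  qed
qed

lemma admissible_binary_le:
  assumes "admissible t {0, 1 :: nat} m"
  shows "m \<le> 2 ^ (t + 1)"
proof -
  obtain n and a b :: "nat \<Rightarrow> nat \<Rightarrow> nat" where n: "t < n"
    and ab: "\<forall>i\<in>{1..m}. a i \<in> {..<n} \<rightarrow>\<^sub>E {0, 1} \<and> b i \<in> {..<n} \<rightarrow>\<^sub>E {0, 1}"
    and far: "\<forall>i\<in>{1..m}. t + 1 \<le> hamming_dist n (a i) (b i)"
    and near: "\<forall>i\<in>{1..m}. \<forall>j\<in>{1..m}. i \<noteq> j \<longrightarrow>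
      hamming_dist n (a i) (b j) + hamming_dist n (a j) (b i) \<le> 2 * t"
    using assms unfolding admissible_def by blast
  define A where "A i = {k \<in> {..<n}. a i k = 1}" for i
  define D where "D i = {k \<in> {..<n}. a i k \<noteq> b i k}" for i
  have hd: "hamming_dist n p q = (\<Sum>k<n. of_bool (p k \<noteq> q k))" for p q :: "nat \<Rightarrow> nat"
    by (simp add: hamming_dist_def Int_def)
  have "card {1..m} \<le> 2 ^ (t + 1)"
  proof (rule card_partial_words_mean_le[where N = "{..<n}" and A = A and D = D])
    fix i j assume ij: "i \<in> {1..m}" "j \<in> {1..m}" "i \<noteq> j"
    let ?C = "sym_diff (A i) (A j) \<inter> (D i \<inter> D j)"
    have card_C: "card ?C = (\<Sum>k<n. of_bool (k \<in> ?C))"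
      by (auto simp: A_def intro!: arg_cong[where f = card])
    \<comment> \<open>This holds coordinate by coordinate. The two cross distances fall short only
      where both pairs differ and \<open>a i k \<noteq> a j k\<close>; binary values then force
      \<open>a i k = b j k\<close> and \<open>a j k = b i k\<close>, a deficit of 2.\<close>
    have "hamming_dist n (a i) (b i) + hamming_dist n (a j) (b j) \<le>
      hamming_dist n (a i) (b j) + hamming_dist n (a j) (b i) + 2 * card ?C"
      unfolding hd card_C sum_distrib_left sum.distrib[symmetric]
    proof (rule sum_mono)
      fix k assume k: "k \<in> {..<n}"
      then have "a i k \<in> {0, 1}" "b i k \<in> {0, 1}" "a j k \<in> {0, 1}" "b j k \<in> {0, 1}"
        using bspec[OF ab ij(1)] bspec[OF ab ij(2)] by (auto simp only: PiE_iff)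
      moreover have "k \<in> ?C \<longleftrightarrow> (a i k = 1) \<noteq> (a j k = 1) \<and> a i k \<noteq> b i k \<and> a j k \<noteq> b j k"
        using k by (simp add: A_def D_def) argo
      ultimately show "of_bool (a i k \<noteq> b i k) + of_bool (a j k \<noteq> b j k) \<le>
        of_bool (a i k \<noteq> b j k) + of_bool (a j k \<noteq> b i k) + 2 * (of_bool (k \<in> ?C) :: nat)"
        by (elim insertE emptyE) simp_all
    qed
    then show "card (D i) + card (D j) \<le> 2 * t + 2 * card ?C"
      using near[rule_format, OF ij] by (simp add: D_def hamming_dist_def)
  qed (use n far in \<open>auto simp: A_def D_def hamming_dist_def\<close>)
  then show ?thesis by simp
qed

lemma admissible_binary_power: "admissible t {0, 1 :: nat} (2 ^ (t + 1))"
proof -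
  let ?n = "t + 1"
  let ?W = "{..<?n} \<rightarrow>\<^sub>E {0, 1 :: nat}"
  have "finite ?W" by (intro finite_PiE) auto
  moreover have "card ?W = 2 ^ ?n" by (subst card_PiE) (simp_all add: numeral_2_eq_2)
  ultimately obtain a :: "nat \<Rightarrow> nat \<Rightarrow> nat" where a: "bij_betw a {1..2 ^ ?n} ?W"
    using ex_bij_betw_nat_finite_1 by metis
  define b where "b i = (\<lambda>k\<in>{..<?n}. 1 - a i k)" for i
  have mem: "a i \<in> ?W" if "i \<in> {1..2 ^ ?n}" for i
    using a that bij_betwE by blast
  have val: "a i k = 0 \<or> a i k = 1" if "i \<in> {1..2 ^ ?n}" "k < ?n" for i k
    using mem[OF that(1)] that(2) by (auto simp only: PiE_iff lessThan_iff)
  have flip: "a i k \<noteq> b j k \<longleftrightarrow> a i k = a j k"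
    if "i \<in> {1..2 ^ ?n}" "j \<in> {1..2 ^ ?n}" "k < ?n" for i j k
    using val[OF that(1,3)] val[OF that(2,3)] that(3) by (auto simp: b_def)
  \<comment> \<open>Distance to a complement counts agreements: all \<open>t + 1\<close> positions
    if \<open>i = j\<close>, and at most \<open>t\<close> for distinct words.\<close>
  have hd: "hamming_dist ?n (a i) (b j) = card {k \<in> {..<?n}. a i k = a j k}"
    if "i \<in> {1..2 ^ ?n}" "j \<in> {1..2 ^ ?n}" for i j
    unfolding hamming_dist_def using flip[OF that] by (intro arg_cong[where f = card]) auto
  have near: "hamming_dist ?n (a i) (b j) \<le> t"
    if ij: "i \<in> {1..2 ^ ?n}" "j \<in> {1..2 ^ ?n}" "i \<noteq> j" for i j
  proof -
    have "a i \<noteq> a j"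
      using a ij by (meson bij_betw_imp_inj_on inj_onD)
    then obtain k where "k \<in> {..<?n}" "a i k \<noteq> a j k"
      using PiE_ext[OF mem[OF ij(1)] mem[OF ij(2)]] by blast
    then have "{k \<in> {..<?n}. a i k = a j k} \<subset> {..<?n}" by blast
    then have "card {k \<in> {..<?n}. a i k = a j k} < card {..<?n}"
      by (rule psubset_card_mono[OF finite_lessThan])
    then show ?thesis using hd[OF ij(1,2)] by simp
  qed
  show ?thesis
    unfolding admissible_def
  proof (intro exI conjI ballI impI)
    show "t < ?n" by simp
    fix i assume i: "i \<in> {1..(2::nat) ^ (t + 1)}"
    show "a i \<in> ?W" by (rule mem[OF i])
    show "b i \<in> ?W" using val[OF i] by (auto simp: b_def)
    show "t + 1 \<le> hamming_dist ?n (a i) (b i)" using hd[OF i i] by simp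
    fix j assume "j \<in> {1..(2::nat) ^ (t + 1)}" "i \<noteq> j"
    then show "hamming_dist ?n (a i) (b j) + hamming_dist ?n (a j) (b i) \<le> 2 * t"
      using near[OF i, of j] near[of j i] i by simp
  qed
qed

theorem theorem1p6:
  fixes t :: nat
  shows "admissible t {0, 1 :: nat} (f_prime t {0, 1 :: nat}) \<and>
    (\<forall>m. admissible t {0, 1 :: nat} m \<longrightarrow> m \<le> f_prime t {0, 1 :: nat}) \<and>
    f_prime t {0, 1 :: nat} = 2 ^ (t + 1)"
proof -
  have "f_prime t {0, 1 :: nat} = 2 ^ (t + 1)"
    unfolding f_prime_def
    by (rule Greatest_equality) (rule admissible_binary_power, rule admissible_binary_le)
  then show ?thesis
    using admissible_binary_power admissible_binary_le by metis
qed

end
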